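(* (a) For each $h\in\{3,4\}$ there exists a caterpillar $C$ with at least $h+7$ vertices such that every $k$-planar $h$-placement of $C$ satisfies $k\ge h-1$. (b) For $h=5$ there exists a caterpillar $C$ with at least $24$ vertices such that every $k$-planar $5$-placement of $C$ satisfies $k\ge h = 5$.
   Context: Graphs are finite and simple. A caterpillar is a tree such that removing all its leaves leaves a path. An $h$-placement of an $n$-vertex graph $H$ is an $n$-vertex graph $G$ (the host graph) that contains $h$ pairwise edge-disjoint spanning subgraphs each isomorphic to $H$. A graph is $k$-planar if it admits a drawing in the plane in which each edge is crossed at most $k$ times. An $h$-placement is $k$-planar if its host graph is $k$-planar. *)

theory Defs
  imports "HOL-Analysis.Analysis"
begin

section \<open>Finite simple graphs\<close>

record 'a sgraph =
  verts :: "'a set"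
  edges :: "'a set set"

definition simple_graph :: "'a sgraph \<Rightarrow> bool" where
  "simple_graph G \<longleftrightarrow>
     finite (verts G) \<and> (\<forall>e \<in> edges G. e \<subseteq> verts G \<and> card e = 2)"

definition adj :: "'a sgraph \<Rightarrow> ('a \<times> 'a) set" where
  "adj G = {(u, v). {u, v} \<in> edges G}"

definition degree :: "'a sgraph \<Rightarrow> 'a \<Rightarrow> nat" where
  "degree G v = card {e \<in> edges G. v \<in> e}"

definition connected_graph :: "'a sgraph \<Rightarrow> bool" where
  "connected_graph G \<longleftrightarrow>
     verts G \<noteq> {} \<and> (\<forall>u \<in> verts G. \<forall>v \<in> verts G. (u, v) \<in> (adj G)\<^sup>*)"

definition is_cycle :: "'a sgraph \<Rightarrow> 'a list \<Rightarrow> bool" where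
  "is_cycle G xs \<longleftrightarrow>
     length xs \<ge> 3 \<and> distinct xs \<and> set xs \<subseteq> verts G \<and>
     (\<forall>i. Suc i < length xs \<longrightarrow> {xs ! i, xs ! Suc i} \<in> edges G) \<and>
     {last xs, hd xs} \<in> edges G"

definition is_tree :: "'a sgraph \<Rightarrow> bool" where
  "is_tree G \<longleftrightarrow> simple_graph G \<and> connected_graph G \<and> (\<nexists>xs. is_cycle G xs)"

text \<open>The list may be empty or a singleton: the null graph and the one-vertex graph count as
  paths, so that the one-edge tree and all stars are caterpillars.\<close>

definition is_path_graph :: "'a sgraph \<Rightarrow> bool" where
  "is_path_graph G \<longleftrightarrow>
     (\<exists>xs. distinct xs \<and> verts G = set xs \<and>
           edges G = {{xs ! i, xs ! Suc i} | i. Suc i < length xs})"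

definition leaves :: "'a sgraph \<Rightarrow> 'a set" where
  "leaves G = {v \<in> verts G. degree G v = 1}"

definition remove_verts :: "'a sgraph \<Rightarrow> 'a set \<Rightarrow> 'a sgraph" where
  "remove_verts G X =
     \<lparr>verts = verts G - X, edges = {e \<in> edges G. e \<inter> X = {}}\<rparr>"

definition caterpillar :: "'a sgraph \<Rightarrow> bool" where
  "caterpillar G \<longleftrightarrow> is_tree G \<and> is_path_graph (remove_verts G (leaves G))"

section \<open>Placements\<close>

definition graph_iso :: "'a sgraph \<Rightarrow> 'b sgraph \<Rightarrow> bool" where
  "graph_iso G H \<longleftrightarrow>
     (\<exists>f. bij_betw f (verts G) (verts H) \<and> edges H = (\<lambda>e. f ` e) ` edges G)"

definition spanning_subgraph :: "'a sgraph \<Rightarrow> 'a sgraph \<Rightarrow> bool" where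
  "spanning_subgraph F G \<longleftrightarrow> verts F = verts G \<and> edges F \<subseteq> edges G"

text \<open>\<open>G\<close> is the host graph; it may have edges that belong to none of the \<open>h\<close> copies of \<open>H\<close>.\<close>

definition is_placement :: "nat \<Rightarrow> 'a sgraph \<Rightarrow> 'b sgraph \<Rightarrow> bool" where
  "is_placement h H G \<longleftrightarrow>
     simple_graph G \<and> card (verts G) = card (verts H) \<and>
     (\<exists>F :: nat \<Rightarrow> 'b sgraph.
        (\<forall>i<h. spanning_subgraph (F i) G \<and> graph_iso H (F i)) \<and>
        (\<forall>i<h. \<forall>j<h. i \<noteq> j \<longrightarrow> edges (F i) \<inter> edges (F j) = {}))"

section \<open>Drawings and $k$-planarity\<close>

text \<open>The plane is the type \<^typ>\<open>complex\<close>. A drawing places the vertices at distinct points and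
  represents every edge by a simple arc joining its two end vertices and meeting no other vertex;
  two distinct edges share only finitely many points. Adjacent edges may cross, and two edges may
  cross repeatedly.\<close>

definition drawing ::
  "'a sgraph \<Rightarrow> ('a \<Rightarrow> complex) \<Rightarrow> ('a set \<Rightarrow> real \<Rightarrow> complex) \<Rightarrow> bool" where
  "drawing G p \<gamma> \<longleftrightarrow>
     inj_on p (verts G) \<and>
     (\<forall>e \<in> edges G. arc (\<gamma> e) \<and>
        {pathstart (\<gamma> e), pathfinish (\<gamma> e)} = p ` e \<and>
        path_image (\<gamma> e) \<inter> p ` verts G = p ` e) \<and>
     (\<forall>e \<in> edges G. \<forall>e' \<in> edges G. e \<noteq> e' \<longrightarrow>
        finite (path_image (\<gamma> e) \<inter> path_image (\<gamma> e')))"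

text \<open>A crossing on \<open>e\<close> is recorded as a pair of another edge and a common point that is not a
  vertex. Thus a point lying on several further edges counts once for each of them, and a point
  where two edges merely touch counts as well. Drawings with such points may be perturbed without
  increasing any of these counts, so allowing them does not change which graphs are
  \<open>k\<close>-planar.\<close>

definition crossings ::
  "'a sgraph \<Rightarrow> ('a \<Rightarrow> complex) \<Rightarrow> ('a set \<Rightarrow> real \<Rightarrow> complex) \<Rightarrow> 'a set \<Rightarrow> ('a set \<times> complex) set"
  where
  "crossings G p \<gamma> e =
     {(e', x). e' \<in> edges G \<and> e' \<noteq> e \<and>
               x \<in> path_image (\<gamma> e) \<inter> path_image (\<gamma> e') - p ` verts G}"

definition k_planar :: "nat \<Rightarrow> 'a sgraph \<Rightarrow> bool" where
  "k_planar k G \<longleftrightarrow>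
     (\<exists>p \<gamma>. drawing G p \<gamma> \<and> (\<forall>e \<in> edges G. card (crossings G p \<gamma> e) \<le> k))"

end

theory Submission
  imports Defs
begin

text \<open>A caterpillar on \<open>n\<close> vertices with a vertex of degree \<open>n - h\<close> forces, in every host graph of
  an \<open>h\<close>-placement, \<open>h\<close> distinct copies of that vertex, since two edge-disjoint copies of the large
  star cannot share their centre. Any three of these centres have at least \<open>n - 3h\<close> common
  neighbours. In a \<open>k\<close>-planar drawing the three edges from such a neighbour to the centres are
  crossed by the edges of at most \<open>3k\<close> other neighbours, so if there are at least \<open>6k + 3\<close> common
  neighbours, three of them have mutually non-crossing edges. This would embed \<open>K\<^sub>3\<^sub>,\<^sub>3\<close> in the plane.
  Hence \<open>k\<close> is unbounded as \<open>n\<close> grows, and it remains to place \<open>h\<close> copies of one such caterpillar;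
  double stars do.\<close>

section \<open>Disjoint stars in the plane\<close>

text \<open>The parameters in \<open>{0..1}\<close> at which \<open>g\<close> lies in
  \<open>P\<close> form a compact set containing 0, so there is a largest one. This cuts a path at
  its last visit to a closed set.\<close>

lemma path_last_hit:
  fixes g :: "real \<Rightarrow> 'a::t2_space"
  assumes "path g" "closed P" "pathstart g \<in> P"
  obtains t where "t \<in> {0..1}" "g t \<in> P" "\<And>u. t < u \<Longrightarrow> u \<le> 1 \<Longrightarrow> g u \<notin> P"
proof -
  let ?S = "{0..1} \<inter> g -` P"
  have "closed ?S"
    using assms by (intro continuous_closed_preimage) (auto simp: path_def)
  then have "compact ?S"
    by (metis compact_Icc compact_Int_closed Int_assoc Int_commute inf.idem)
  moreover have "0 \<in> ?S"
    using assms by (auto simp: pathstart_def)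
  ultimately obtain t where "t \<in> ?S" "\<forall>u\<in>?S. u \<le> t"
    using compact_attains_sup[of ?S] by blast
  then have "g u \<notin> P" if "t < u" "u \<le> 1" for u
    using that by (auto simp: not_le[symmetric])
  with \<open>t \<in> ?S\<close> show thesis
    by (intro that[of t]) auto
qed

text \<open>Only the outer ends are kept off the other two arcs; crossings elsewhere are permitted
  because a drawing allows edges with a common end to cross.\<close>

definition star_at :: "complex \<Rightarrow> complex \<Rightarrow> complex \<Rightarrow> complex \<Rightarrow>
    (real \<Rightarrow> complex) \<Rightarrow> (real \<Rightarrow> complex) \<Rightarrow> (real \<Rightarrow> complex) \<Rightarrow> bool" where
  "star_at w a b c A B C \<longleftrightarrow>
     arc A \<and> pathstart A = w \<and> pathfinish A = a \<and> a \<notin> path_image B \<union> path_image C \<and>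
     arc B \<and> pathstart B = w \<and> pathfinish B = b \<and> b \<notin> path_image A \<union> path_image C \<and>
     arc C \<and> pathstart C = w \<and> pathfinish C = c \<and> c \<notin> path_image A \<union> path_image B"

text \<open>The arcs of a star may cross each other away from its centre; following \<open>B\<close> and then \<open>C\<close>
  inwards up to the first hit yields three arcs that meet in a single point. The arcs to \<open>a\<close> and
  \<open>b\<close> together form \<open>Q\<close>.\<close>

lemma star_contains_tripod:
  assumes "star_at w a b c A B C"
  obtains Q A' B' C' where
    "arc Q" "pathstart Q = a" "pathfinish Q = b" "path_image Q = A' \<union> B'"
    "compact A'" "compact B'" "compact C'" "connected C'" "connected (C' - path_image Q)"
    "A' \<inter> B' \<subseteq> C'" "a \<in> A'" "b \<in> B'" "c \<in> C'" "a \<notin> B' \<union> C'" "b \<notin> A' \<union> C'" "c \<notin> A' \<union> B'"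
    "A' \<union> B' \<union> C' \<subseteq> path_image A \<union> path_image B \<union> path_image C"
proof -
  have A: "arc A" "A 0 = w" "A 1 = a" "a \<notin> path_image B" "a \<notin> path_image C"
    and B: "arc B" "B 0 = w" "B 1 = b" "b \<notin> path_image A" "b \<notin> path_image C"
    and C: "arc C" "C 0 = w" "C 1 = c" "c \<notin> path_image A" "c \<notin> path_image B"
    using assms unfolding star_at_def by (auto simp: pathstart_def pathfinish_def)
  have PI: "f u \<in> path_image f" if "0 \<le> u" "u \<le> 1" for f :: "real \<Rightarrow> complex" and u
    using that by (auto simp: path_image_def)
  have "pathstart B \<in> path_image A"
    using A B PI[of 0 A] by (simp add: pathstart_def)
  \<comment> \<open>Beyond parameter \<open>r\<close> the arc \<open>B\<close> has left
    \<open>A\<close> for good; \<open>A s = B r\<close> is where the two are spliced.\<close>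
  then obtain r where r: "r \<in> {0..1}" "B r \<in> path_image A"
    "\<And>u. r < u \<Longrightarrow> u \<le> 1 \<Longrightarrow> B u \<notin> path_image A"
    using path_last_hit[of B "path_image A"] B A
    by (metis arc_imp_path closed_arc_image)
  then obtain s where s: "s \<in> {0..1}" "A s = B r"
    by (auto simp: path_image_def)
  have "s \<noteq> 1" using s A r PI[of r B] by auto
  have "r \<noteq> 1" using r B by auto
  \<comment> \<open>\<open>Q\<close> runs from \<open>a\<close> back along \<open>A\<close> to the
    splice point and then along \<open>B\<close> to \<open>b\<close>.\<close>
  define Q where "Q = subpath 1 s A +++ subpath r 1 B"
  have imA: "path_image (subpath 1 s A) = A ` {s..1}"
    using s by (auto simp: path_image_subpath)
  have imB: "path_image (subpath r 1 B) = B ` {r..1}"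
    using r by (auto simp: path_image_subpath)
  have imAs: "A ` {s..1} \<subseteq> path_image A" and imBs: "B ` {r..1} \<subseteq> path_image B"
    using s r by (auto simp: path_image_def)
  have fs: "pathfinish (subpath 1 s A) = pathstart (subpath r 1 B)"
    by (simp add: s)
  have arcQ: "arc Q" unfolding Q_def
  proof (rule arc_join)
    show "arc (subpath 1 s A)" "arc (subpath r 1 B)"
      using \<open>s \<noteq> 1\<close> \<open>r \<noteq> 1\<close> s r A B by (auto intro!: arc_subpath_arc)
    show "path_image (subpath 1 s A) \<inter> path_image (subpath r 1 B) \<subseteq> {pathstart (subpath r 1 B)}"
      unfolding imA imB using r(3) imAs by (force simp: less_le)
  qed (rule fs)
  have imQ: "path_image Q = A ` {s..1} \<union> B ` {r..1}"
    unfolding Q_def using path_image_join[OF fs] by (simp add: imA imB)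
  have Q01: "Q 0 = a" "Q 1 = b"
    using pathstart_join[of "subpath 1 s A" "subpath r 1 B"]
      pathfinish_join[of "subpath 1 s A" "subpath r 1 B"] A B
    by (simp_all add: Q_def pathstart_def pathfinish_def subpath_def)
  define g where "g = subpath s 0 A +++ C"
  have fs': "pathfinish (subpath s 0 A) = pathstart C"
    using A C by (simp add: pathstart_def)
  have pg: "path g" unfolding g_def
    using fs' A C s arc_imp_path[of A] arc_imp_path[of C]
    by (auto intro!: path_join_imp path_subpath)
  have img: "path_image g = A ` {0..s} \<union> path_image C"
    unfolding g_def using path_image_join[OF fs'] s by (auto simp: path_image_subpath)
  have "a \<notin> A ` {0..s}"
  proof
    assume "a \<in> A ` {0..s}"
    then obtain u where u: "0 \<le> u" "u \<le> s" "A u = A 1" using A by auto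
    then have "u = 1" using A(1) s by (auto simp: arc_def inj_on_def)
    then show False using u s \<open>s \<noteq> 1\<close> by auto
  qed
  then have ag: "a \<notin> path_image g" using A img by auto
  have "A ` {0..s} \<subseteq> path_image A" using s by (auto simp: path_image_def)
  then have bg: "b \<notin> path_image g" using B img by auto
  have g1: "g 1 = c" using C by (simp add: g_def joinpaths_def)
  have cQ: "c \<notin> path_image Q" using C imQ imAs imBs by auto
  have "pathstart g \<in> path_image Q"
    unfolding g_def imQ using s(1) by simp
  \<comment> \<open>The last visit of \<open>g\<close> to \<open>Q\<close> is the branch point of
    the tripod. Its parameter \<open>v\<close> on \<open>Q\<close> splits \<open>Q\<close> into the
    legs to \<open>a\<close> and \<open>b\<close>; the rest of \<open>g\<close> is the leg to
    \<open>c\<close>.\<close>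
  then obtain t where t: "t \<in> {0..1}" "g t \<in> path_image Q"
    "\<And>u. t < u \<Longrightarrow> u \<le> 1 \<Longrightarrow> g u \<notin> path_image Q"
    using path_last_hit[OF pg closed_arc_image[OF arcQ]] by metis
  then obtain v where v: "v \<in> {0..1}" "Q v = g t" by (auto simp: path_image_def)
  have gt: "g ` {t..1} \<subseteq> path_image g" using t by (auto simp: path_image_def)
  have Qinj: "x = y" if "Q x = Q y" "x \<in> {0..1}" "y \<in> {0..1}" for x y
    using arcQ that by (auto simp: arc_def inj_on_def)
  have "t \<noteq> 1" using t g1 cQ by auto
  \<comment> \<open>Removing \<open>Q\<close> from the third leg deletes only the branch point, so
    what remains is the image of an interval and hence connected.\<close>
  have diff: "g ` {t..1} - path_image Q = g ` {t<..1}"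
    using t by (force simp: less_le)
  have cg: "continuous_on {t..1} g" and cQ': "continuous_on {0..1} Q"
    using pg t arcQ by (auto simp: path_def arc_def elim!: continuous_on_subset)
  have gtv: "g t \<in> path_image g" using t PI by auto
  \<comment> \<open>The path \<open>g\<close> avoids \<open>a\<close> and \<open>b\<close>, so the
    branch point is interior to \<open>Q\<close>.\<close>
  have v0: "v \<noteq> 0" "v \<noteq> 1"
    using v Q01 gtv ag bg by auto
  show thesis
  proof (rule that[of Q "Q ` {0..v}" "Q ` {v..1}" "g ` {t..1}"])
    show "path_image Q = Q ` {0..v} \<union> Q ` {v..1}"
      using v by (force simp: path_image_def)
    show "compact (Q ` {0..v})" "compact (Q ` {v..1})"
      using v by (auto intro!: compact_continuous_image continuous_on_subset[OF cQ'])
    show "compact (g ` {t..1})" "connected (g ` {t..1})"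
      using cg by (auto intro!: compact_continuous_image connected_continuous_image)
    show "connected (g ` {t..1} - path_image Q)"
      unfolding diff
      by (auto intro!: connected_continuous_image continuous_on_subset[OF cg])
    show "Q ` {0..v} \<inter> Q ` {v..1} \<subseteq> g ` {t..1}"
    proof clarify
      fix x y assume "x \<in> {0..v}" "y \<in> {v..1}" "Q x = Q y"
      then have "x = y" using v by (intro Qinj) auto
      then have "x = v" using \<open>x \<in> {0..v}\<close> \<open>y \<in> {v..1}\<close> by auto
      then show "Q x \<in> g ` {t..1}" using v t by auto
    qed
    show "a \<notin> Q ` {v..1} \<union> g ` {t..1}"
    proof -
      have "a \<notin> Q ` {v..1}"
      proof
        assume "a \<in> Q ` {v..1}"
        then obtain y where y: "y \<in> {v..1}" "Q y = Q 0" using Q01 by auto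
        then have "y = 0" using v by (intro Qinj) auto
        then show False using y v v0 by auto
      qed
      then show ?thesis using ag gt by auto
    qed
    show "b \<notin> Q ` {0..v} \<union> g ` {t..1}"
    proof -
      have "b \<notin> Q ` {0..v}"
      proof
        assume "b \<in> Q ` {0..v}"
        then obtain y where y: "y \<in> {0..v}" "Q y = Q 1" using Q01 by auto
        then have "y = 1" using v by (intro Qinj) auto
        then show False using y v v0 by auto
      qed
      then show ?thesis using bg gt by auto
    qed
    show "c \<notin> Q ` {0..v} \<union> Q ` {v..1}" using cQ v by (auto simp: path_image_def)
    show "Q ` {0..v} \<union> Q ` {v..1} \<union> g ` {t..1} \<subseteq> path_image A \<union> path_image B \<union> path_image C"
    proof -
      have "path_image Q \<subseteq> path_image A \<union> path_image B"
        unfolding imQ by (rule Un_mono[OF imAs imBs])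
      moreover have "Q ` {0..v} \<union> Q ` {v..1} \<subseteq> path_image Q"
        unfolding path_image_def using v(1) by (intro Un_least image_mono) auto
      moreover have "path_image g \<subseteq> path_image A \<union> path_image C"
        unfolding img by (rule Un_mono[OF \<open>A ` {0..s} \<subseteq> path_image A\<close> order_refl])
      ultimately have "(Q ` {0..v} \<union> Q ` {v..1}) \<union> g ` {t..1} \<subseteq>
          (path_image A \<union> path_image B) \<union> (path_image A \<union> path_image C)"
        by (meson Un_mono gt order_trans)
      then show ?thesis by (simp only: Un_ac Un_absorb Un_left_absorb)
    qed
    show "pathstart Q = a" "pathfinish Q = b"
      using Q01 by (simp_all add: pathstart_def pathfinish_def)
    have "Q 0 \<in> Q ` {0..v}" "Q 1 \<in> Q ` {v..1}" "g 1 \<in> g ` {t..1}"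
      using v(1) t(1) by auto
    then show "a \<in> Q ` {0..v}" "b \<in> Q ` {v..1}" "c \<in> g ` {t..1}"
      by (simp_all only: Q01 g1)
  qed (rule arcQ)
qed

text \<open>An arc without its last point is the image of \<open>{0..<1}\<close>: it is connected
  and has the missing point in its closure. The three truncated arcs share \<open>w\<close>.\<close>

lemma star_minus_ends:
  assumes "star_at w a b c A B C"
  defines "S \<equiv> path_image A \<union> path_image B \<union> path_image C - {a, b, c}"
  shows "connected S" "w \<in> S" "a \<in> closure S" "b \<in> closure S" "c \<in> closure S"
proof -
  have *: "connected (path_image f - {z}) \<and> w \<in> path_image f - {z} \<and> z \<in> closure (path_image f - {z})"
    if "arc f" "pathstart f = w" "pathfinish f = z" for f :: "real \<Rightarrow> complex" and z
  proof -
    have inj: "inj_on f {0..1}" and cont: "continuous_on {0..1} f" and f: "f 0 = w" "f 1 = z"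
      using that by (auto simp: arc_def path_def pathstart_def pathfinish_def)
    have eq: "path_image f - {z} = f ` {0..<1}"
    proof (intro equalityI subsetI)
      fix x assume "x \<in> path_image f - {z}"
      then show "x \<in> f ` {0..<1}" using f by (force simp: path_image_def less_le)
    next
      fix x assume "x \<in> f ` {0..<1}"
      then obtain u where u: "u \<in> {0..<1}" "x = f u" by auto
      then have "f u \<noteq> f 1" using inj_onD[OF inj, of u 1] by auto
      then show "x \<in> path_image f - {z}" using u f by (auto simp: path_image_def)
    qed
    have "f ` closure {0..<1} \<subseteq> closure (f ` {0..<1})"
      using cont by (intro image_closure_subset[OF _ _ closure_subset]) (auto simp: closure_subset)
    then have "z \<in> closure (f ` {0..<1})" using f by auto
    moreover have "connected (f ` {0..<1})"
      by (intro connected_continuous_image continuous_on_subset[OF cont]) auto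
    ultimately show ?thesis unfolding eq using f by auto
  qed
  have st: "arc A" "pathstart A = w" "pathfinish A = a"
     "arc B" "pathstart B = w" "pathfinish B = b"
     "arc C" "pathstart C = w" "pathfinish C = c"
    and n: "a \<notin> path_image B \<union> path_image C" "b \<notin> path_image A \<union> path_image C"
      "c \<notin> path_image A \<union> path_image B"
    using assms by (auto simp: star_at_def)
  note 1 = *[OF st(1-3)] and 2 = *[OF st(4-6)] and 3 = *[OF st(7-9)]
  have S: "S = (path_image A - {a}) \<union> (path_image B - {b}) \<union> (path_image C - {c})"
    using n unfolding S_def by auto
  show "connected S" unfolding S using 1 2 3 by (intro connected_Un) auto
  show "w \<in> S" unfolding S using 1 by auto
  show "a \<in> closure S" "b \<in> closure S" "c \<in> closure S"
    unfolding S using 1 2 3 by (auto simp: closure_Un)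
qed

text \<open>Tripods in the first two stars form a theta curve through \<open>a\<close>, \<open>b\<close>, \<open>c\<close>, and the third star minus
  its ends is a connected set \<open>\<sigma>\<close> off that curve with all three points in its closure. Let \<open>E\<close> be
  the side of the Jordan curve \<open>J\<close> through \<open>a\<close> and \<open>b\<close> that avoids \<open>\<sigma>\<close>; it also avoids the third
  arc, as \<open>c\<close> lies on the side of \<open>\<sigma>\<close>. Neither the part \<open>S\<close> of the theta curve avoiding \<open>b\<close> nor the
  part \<open>T\<close> avoiding \<open>a\<close> separates \<open>E\<close> from \<open>\<sigma>\<close>, because the missing point links the two. As \<open>S \<inter> T\<close>
  is connected, neither does \<open>S \<union> T \<supseteq> J\<close>, by Janiszewski's theorem.\<close>

lemma no_three_disjoint_stars:
  assumes s1: "star_at w1 a b c A1 B1 C1"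
    and s2: "star_at w2 a b c A2 B2 C2"
    and s3: "star_at w3 a b c A3 B3 C3"
    and d12: "(path_image A1 \<union> path_image B1 \<union> path_image C1) \<inter>
      (path_image A2 \<union> path_image B2 \<union> path_image C2) \<subseteq> {a, b, c}"
    and d13: "(path_image A1 \<union> path_image B1 \<union> path_image C1) \<inter>
      (path_image A3 \<union> path_image B3 \<union> path_image C3) \<subseteq> {a, b, c}"
    and d23: "(path_image A2 \<union> path_image B2 \<union> path_image C2) \<inter>
      (path_image A3 \<union> path_image B3 \<union> path_image C3) \<subseteq> {a, b, c}"
  shows False
proof -
  define U1 where "U1 = path_image A1 \<union> path_image B1 \<union> path_image C1"
  define U2 where "U2 = path_image A2 \<union> path_image B2 \<union> path_image C2"
  define \<sigma> where "\<sigma> = path_image A3 \<union> path_image B3 \<union> path_image C3 - {a, b, c}"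
  note \<sigma> = star_minus_ends[OF s3, folded \<sigma>_def]
  have d: "U1 \<inter> U2 \<subseteq> {a,b,c}" "U1 \<inter> \<sigma> = {}" "U2 \<inter> \<sigma> = {}"
    using d12 d13 d23 unfolding U1_def U2_def \<sigma>_def by blast+
  obtain Q X Y Z where 1:
    "arc Q" "pathstart Q = a" "pathfinish Q = b" "path_image Q = X \<union> Y"
    "compact X" "compact Y" "compact Z" "connected Z" "connected (Z - path_image Q)"
    "X \<inter> Y \<subseteq> Z" "a \<in> X" "b \<in> Y" "c \<in> Z" "a \<notin> Y \<union> Z" "b \<notin> X \<union> Z" "c \<notin> X \<union> Y"
    "X \<union> Y \<union> Z \<subseteq> U1"
    unfolding U1_def by (rule star_contains_tripod[OF s1])
  obtain Q' X' Y' Z' where 2: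
    "arc Q'" "pathstart Q' = a" "pathfinish Q' = b" "path_image Q' = X' \<union> Y'"
    "compact X'" "compact Y'" "compact Z'" "connected Z'" "connected (Z' - path_image Q')"
    "X' \<inter> Y' \<subseteq> Z'" "a \<in> X'" "b \<in> Y'" "c \<in> Z'" "a \<notin> Y' \<union> Z'" "b \<notin> X' \<union> Z'" "c \<notin> X' \<union> Y'"
    "X' \<union> Y' \<union> Z' \<subseteq> U2"
    unfolding U2_def by (rule star_contains_tripod[OF s2])
  define J where "J = X \<union> Y \<union> X' \<union> Y'"
  define L where "L = Q +++ reversepath Q'"
  have imL: "path_image L = J"
    unfolding L_def J_def using 1(1-4) 2(1-4) by (subst path_image_join) auto
  have XY: "(X \<union> Y) \<inter> (X' \<union> Y') \<subseteq> {a,b}"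
    using d 1(13-17) 2(13-17) by blast
  have sL: "simple_path L" unfolding L_def
    using 1(1-4) 2(1-4) XY by (intro simple_path_join_loop) (auto simp: arc_reversepath)
  have "pathfinish L = pathstart L" unfolding L_def using 1(1-4) 2(1-4) by simp
  from Jordan_curve[OF sL this]
  obtain I O' where IO: "I \<noteq> {}" "open I" "connected I" "O' \<noteq> {}" "open O'" "connected O'"
    "I \<inter> O' = {}" "I \<union> O' = - J" "frontier I = J" "frontier O' = J"
    unfolding imL by metis
  have \<sigma>J: "\<sigma> \<subseteq> I \<union> O'" using d 1(17) 2(17) unfolding IO J_def by blast
  \<comment> \<open>\<open>D\<close> is the side of \<open>J\<close> containing the connected set
    \<open>\<sigma>\<close>, whichever of the two Jordan components that is.\<close>
  obtain D E where DE: "E \<noteq> {}" "open E" "connected E" "open D" "D \<inter> E = {}" "D \<union> E = - J"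
     "frontier E = J" "\<sigma> \<subseteq> D"
  proof -
    have "\<sigma> \<subseteq> I \<or> \<sigma> \<subseteq> O'"
      using connectedD[OF \<sigma>(1) IO(2,5)] \<sigma>J IO(7) by blast
    then show thesis using that[of O' I] that[of I O'] IO by blast
  qed
  obtain x where x: "x \<in> E" using DE by auto
  have cJ: "c \<notin> J" using 1(16) 2(16) unfolding J_def by auto
  have cD: "c \<in> D"
  proof (rule ccontr)
    assume "c \<notin> D"
    then have "c \<in> E" using cJ DE by blast
    then have "E \<inter> closure \<sigma> \<noteq> {}" using \<sigma> by auto
    then have "E \<inter> \<sigma> \<noteq> {}" using DE(2) open_Int_closure_eq_empty by blast
    then show False using DE by blast
  qed
  \<comment> \<open>A connected set off \<open>J\<close> that contains \<open>c\<close> stays on the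
    side \<open>D\<close>. This is applied to the legs \<open>Z\<close> and \<open>Z'\<close>
    without their branch points, so neither leg enters \<open>E\<close>.\<close>
  have ZD: "z \<in> D" if "connected (z0 - q)" "c \<in> z0 - q" "z0 - q \<subseteq> D \<union> E" "z \<in> z0 - q" for z0 q z
    using connectedD[OF that(1) DE(4,2)] that cD DE(5) by blast
  have "Z \<inter> J \<subseteq> path_image Q"
    using d 1(13-17) 2(13-17) unfolding J_def 1(4) by blast
  then have "Z - path_image Q \<subseteq> D \<union> E" unfolding DE by blast
  then have "Z - path_image Q \<subseteq> D" using ZD[OF 1(9)] 1(4,13,16) by blast
  then have EZ: "E \<inter> Z = {}" using DE(5,6) 1(4) unfolding J_def by blast
  have "Z' \<inter> J \<subseteq> path_image Q'"
    using d 1(13-17) 2(13-17) unfolding J_def 2(4) by blast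
  then have "Z' - path_image Q' \<subseteq> D \<union> E" unfolding DE by blast
  then have "Z' - path_image Q' \<subseteq> D" using ZD[OF 2(9)] 2(4,13,16) by blast
  then have EZ': "E \<inter> Z' = {}" using DE(5,6) 2(4) unfolding J_def by blast
  have EJ: "E \<inter> J = {}" using DE by blast
  define S where "S = X \<union> X' \<union> Z \<union> Z'"
  define T where "T = Y \<union> Y' \<union> Z \<union> Z'"
  \<comment> \<open>Every point of \<open>J\<close> is in the closure of \<open>E\<close>. If
    \<open>z\<close> is also in the closure of \<open>\<sigma>\<close>, then \<open>E\<close>,
    \<open>z\<close> and \<open>\<sigma>\<close> together are connected, and they contain both
    \<open>x\<close> and \<open>w3\<close>.\<close>
  have cc: "connected_component (- R) x w3"
    if "R \<inter> E = {}" "R \<inter> \<sigma> = {}" "z \<notin> R" "z \<in> J" "z \<in> closure \<sigma>" for R z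
  proof -
    have "z \<in> closure E" using that DE(7) by (auto simp: frontier_def)
    then have "connected (insert z E)"
      by (intro connected_intermediate_closure[OF DE(3)]) (auto intro: closure_subset[THEN subsetD])
    moreover have "connected (insert z \<sigma>)"
      using that \<sigma> by (intro connected_intermediate_closure[OF \<sigma>(1)])
        (auto intro: closure_subset[THEN subsetD])
    ultimately have "connected (insert z E \<union> insert z \<sigma>)"
      by (intro connected_Un) auto
    then show ?thesis unfolding connected_component_def
      using that x \<sigma>(2) by (intro exI[of _ "insert z E \<union> insert z \<sigma>"]) auto
  qed
  have "connected_component (- S) x w3"
    using d 1(11-17) 2(11-17) EZ EZ' EJ \<sigma>
    unfolding S_def J_def by (intro cc[of _ b]) (auto simp: J_def)
  moreover have "connected_component (- T) x w3"
    using d 1(11-17) 2(11-17) EZ EZ' EJ \<sigma>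
    unfolding T_def J_def by (intro cc[of _ a]) (auto simp: J_def)
  \<comment> \<open>The two tripods can share only \<open>a\<close>, \<open>b\<close>,
    \<open>c\<close>, and none of these lies on both legs. Thus \<open>S\<close> and
    \<open>T\<close> overlap only in the legs to \<open>c\<close>, which are joined at
    \<open>c\<close>.\<close>
  moreover have "X \<inter> Y' = {}" "X' \<inter> Y = {}"
    using d(1) 1(14-17) 2(14-17) by blast+
  then have "S \<inter> T = Z \<union> Z'"
    using 1(10) 2(10) unfolding S_def T_def by blast
  then have "connected (S \<inter> T)" using 1 2 by (auto intro!: connected_Un)
  moreover have "compact S" "closed T"
    using 1 2 unfolding S_def T_def by (auto intro!: compact_Un compact_imp_closed)
  ultimately have "connected_component (- (S \<union> T)) x w3"
    by (intro Janiszewski)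
  then obtain K where K: "connected K" "K \<subseteq> - (S \<union> T)" "x \<in> K" "w3 \<in> K"
    unfolding connected_component_def by auto
  have "K \<subseteq> D \<union> E" using K(2) unfolding DE S_def T_def J_def by blast
  then show False
    using connectedD[OF K(1) DE(4,2)] DE(5,8) K(3,4) x \<sigma>(2) by blast
qed

section \<open>Crossings in a drawing\<close>

text \<open>Greedy choice: two chosen elements together with everything related to them exclude at
  most \<open>2 * d + 2\<close> members of \<open>W\<close>.\<close>

lemma three_independent_elements:
  assumes "finite W" and "2 * d + 3 \<le> card W"
    and sym: "\<And>u v. R u v \<Longrightarrow> R v u"
    and deg: "\<And>w. w \<in> W \<Longrightarrow> card {v \<in> W. v \<noteq> w \<and> R w v} \<le> d"
  obtains u v w where "{u, v, w} \<subseteq> W" "u \<noteq> v" "u \<noteq> w" "v \<noteq> w" "\<not> R u v" "\<not> R u w" "\<not> R v w"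
proof -
  let ?N = "\<lambda>w. {v \<in> W. v \<noteq> w \<and> R w v}"
  have ex: "\<exists>x\<in>W. x \<notin> X" if "finite X" "card X < card W" for X
    using that by (meson card_mono not_le subsetI)
  obtain u where u: "u \<in> W" using ex[of "{}"] assms by auto
  have "card (insert u (?N u)) \<le> Suc (card (?N u))" by (rule card_insert_le_m1) auto
  then obtain v where v: "v \<in> W" "v \<notin> insert u (?N u)"
    using ex[of "insert u (?N u)"] assms deg[OF u] by force
  let ?X = "{u, v} \<union> (?N u \<union> ?N v)"
  have "card ?X \<le> card {u, v} + (card (?N u) + card (?N v))"
    by (meson card_Un_le add_left_mono order_trans)
  also have "\<dots> \<le> 2 + (d + d)"
    using deg[OF u] deg[OF v(1)] by (intro add_mono) (auto simp: card_insert_if)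
  finally obtain w where "w \<in> W" "w \<notin> ?X"
    using ex[of ?X] assms by force
  then show thesis
    using that[of u v w] u v by auto
qed

lemma finite_edges: "simple_graph G \<Longrightarrow> finite (edges G)"
  unfolding simple_graph_def by (meson PowI finite_Pow_iff finite_subset subsetI)

text \<open>Since \<open>card\<close> is 0 on infinite sets, the bound in \<open>k_planar\<close> is
  informative only once finiteness is known. There are finitely many edges, and any two share
  finitely many points.\<close>

lemma finite_crossings:
  assumes "simple_graph G" "drawing G p \<gamma>" "e \<in> edges G"
  shows "finite (crossings G p \<gamma> e)"
proof (rule finite_subset)
  show "crossings G p \<gamma> e \<subseteq>
      (SIGMA e' : edges G - {e}. path_image (\<gamma> e) \<inter> path_image (\<gamma> e'))"
    unfolding crossings_def by auto
  show "finite \<dots>"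
    using assms finite_edges[OF assms(1)] unfolding drawing_def by (intro finite_SigmaI) auto
qed

text \<open>Edges are unordered, so the drawn arc may run either way; it is reversed if
  necessary.\<close>

lemma drawing_arc_from:
  assumes "drawing G p \<gamma>" "{w, v} \<in> edges G"
  obtains f where "arc f" "pathstart f = p w" "pathfinish f = p v"
    "path_image f = path_image (\<gamma> {w, v})"
proof -
  let ?f = "\<gamma> {w, v}"
  have f: "arc ?f" "{pathstart ?f, pathfinish ?f} = {p w, p v}"
    using assms unfolding drawing_def by auto
  then consider "pathstart ?f = p w" "pathfinish ?f = p v" | "pathstart ?f = p v" "pathfinish ?f = p w"
    by (auto simp: doubleton_eq_iff)
  then show thesis
    using that[of ?f] that[of "reversepath ?f"] f by cases (auto simp: arc_reversepath)
qed

lemma drawing_star: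
  assumes sg: "simple_graph G" and dr: "drawing G p \<gamma>"
    and ne: "a \<noteq> b" "a \<noteq> c" "b \<noteq> c"
    and ed: "{w, a} \<in> edges G" "{w, b} \<in> edges G" "{w, c} \<in> edges G"
  obtains A B C where "star_at (p w) (p a) (p b) (p c) A B C"
    "path_image A = path_image (\<gamma> {w, a})" "path_image B = path_image (\<gamma> {w, b})"
    "path_image C = path_image (\<gamma> {w, c})"
proof -
  have V: "{w, a} \<subseteq> verts G" "{w, b} \<subseteq> verts G" "{w, c} \<subseteq> verts G"
    and "card {w, a} = 2" "card {w, b} = 2" "card {w, c} = 2"
    using sg ed unfolding simple_graph_def by auto
  then have w: "w \<noteq> a" "w \<noteq> b" "w \<noteq> c" by auto
  have inj: "inj_on p (verts G)" using dr by (simp add: drawing_def)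
  have avoid: "p x \<notin> path_image (\<gamma> {w, v})" if "{w, v} \<in> edges G" "x \<in> verts G" "x \<noteq> w" "x \<noteq> v" for x v
  proof
    assume "p x \<in> path_image (\<gamma> {w, v})"
    then have "p x \<in> p ` {w, v}"
      using dr that unfolding drawing_def by blast
    moreover have "{w, v} \<subseteq> verts G" using sg that unfolding simple_graph_def by auto
    ultimately show False using inj that by (auto simp: inj_on_def)
  qed
  obtain A where A: "arc A" "pathstart A = p w" "pathfinish A = p a"
    "path_image A = path_image (\<gamma> {w, a})" by (rule drawing_arc_from[OF dr ed(1)])
  obtain B where B: "arc B" "pathstart B = p w" "pathfinish B = p b"
    "path_image B = path_image (\<gamma> {w, b})" by (rule drawing_arc_from[OF dr ed(2)])
  obtain C where C: "arc C" "pathstart C = p w" "pathfinish C = p c"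
    "path_image C = path_image (\<gamma> {w, c})" by (rule drawing_arc_from[OF dr ed(3)])
  show thesis
  proof (rule that[of A B C])
    show "star_at (p w) (p a) (p b) (p c) A B C"
      unfolding star_at_def using A B C avoid ed V ne w by auto
  qed (use A B C in auto)
qed

text \<open>Two members of \<open>W\<close> conflict if their edges to \<open>a\<close>,
  \<open>b\<close>, \<open>c\<close> meet outside the vertices. Each has at most
  \<open>3 * k\<close> conflicts, so \<open>6 * k + 3\<close> members would include three without
  mutual conflict, against \<open>no_three_disjoint_stars\<close>.\<close>

lemma k_planar_common_neighbours:
  assumes sg: "simple_graph G" and kp: "k_planar k G"
    and ne: "a \<noteq> b" "a \<noteq> c" "b \<noteq> c"
    and fin: "finite W"
    and ed: "\<And>w v. w \<in> W \<Longrightarrow> v \<in> {a, b, c} \<Longrightarrow> {w, v} \<in> edges G"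
  shows "card W < 6 * k + 3"
proof (rule ccontr)
  assume "\<not> card W < 6 * k + 3"
  obtain p \<gamma> where dr: "drawing G p \<gamma>"
    and cr: "\<And>e. e \<in> edges G \<Longrightarrow> card (crossings G p \<gamma> e) \<le> k"
    using kp unfolding k_planar_def by auto
  have inj: "inj_on p (verts G)" using dr by (simp add: drawing_def)
  have W: "w \<notin> {a, b, c}" if "w \<in> W" for w
  proof
    assume "w \<in> {a, b, c}"
    then have "{w, w} \<in> edges G" using ed[OF that] by blast
    then show False using sg unfolding simple_graph_def by fastforce
  qed
  define st where "st w = (\<lambda>v. {w, v}) ` {a, b, c}" for w
  define R where "R w w' \<longleftrightarrow> (\<exists>e\<in>st w. \<exists>e'\<in>st w'.
    \<not> path_image (\<gamma> e) \<inter> path_image (\<gamma> e') \<subseteq> p ` verts G)" for w w'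
  have deg: "card {w' \<in> W. w' \<noteq> w \<and> R w w'} \<le> 3 * k" if w: "w \<in> W" for w
  proof -
    define X where "X = (\<Union>e\<in>st w. fst ` crossings G p \<gamma> e)"
    have ste: "st w \<subseteq> edges G" using ed[OF w] by (auto simp: st_def)
    have finX: "finite X"
      unfolding X_def using ste finite_crossings[OF sg dr] by (auto simp: st_def)
    have "card (fst ` crossings G p \<gamma> e) \<le> k" if "e \<in> st w" for e
    proof -
      have "e \<in> edges G" using ste that by auto
      with cr[OF this] card_image_le[OF finite_crossings[OF sg dr this], of fst]
      show ?thesis by linarith
    qed
    then have "(\<Sum>e\<in>st w. card (fst ` crossings G p \<gamma> e)) \<le> of_nat (card (st w)) * k"
      by (rule sum_bounded_above)
    moreover have "card X \<le> (\<Sum>e\<in>st w. card (fst ` crossings G p \<gamma> e))"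
      unfolding X_def by (rule card_UN_le) (simp add: st_def)
    ultimately have "card X \<le> card (st w) * k" by simp
    also have "card (st w) \<le> 3"
      unfolding st_def by (rule order_trans[OF card_image_le]) (auto simp: card_insert_if)
    finally have X3: "card X \<le> 3 * k" by simp
    \<comment> \<open>A conflicting \<open>w'\<close> contributes an edge to \<open>X\<close> and
      can be read off from it as the only end outside \<open>{a, b, c}\<close>. Hence there are no
      more conflicts than crossing edges.\<close>
    have "{w' \<in> W. w' \<noteq> w \<and> R w w'} \<subseteq> (\<lambda>e. the_elem (e - {a, b, c})) ` X"
    proof clarify
      fix w' assume w': "w' \<in> W" "w' \<noteq> w" "R w w'"
      then obtain e v x where e: "e \<in> st w" "v \<in> {a, b, c}"
        "x \<in> path_image (\<gamma> e) \<inter> path_image (\<gamma> {w', v}) - p ` verts G"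
        unfolding R_def st_def by blast
      have "w' \<notin> e" using e(1) w' W[OF w'(1)] by (auto simp: st_def)
      then have "({w', v}, x) \<in> crossings G p \<gamma> e"
        unfolding crossings_def using e ed[OF w'(1) e(2)] by auto
      then have "{w', v} \<in> X" unfolding X_def using e(1) by force
      moreover have "{w', v} - {a, b, c} = {w'}" using e(2) W[OF w'(1)] by auto
      ultimately show "w' \<in> (\<lambda>e. the_elem (e - {a, b, c})) ` X"
        by (metis (no_types, lifting) image_eqI the_elem_eq)
    qed
    then have "card {w' \<in> W. w' \<noteq> w \<and> R w w'} \<le> card X"
      using finX by (meson card_image_le card_mono finite_imageI order_trans)
    with X3 show ?thesis by simp
  qed
  obtain u v w where uvw: "{u, v, w} \<subseteq> W" "u \<noteq> v" "u \<noteq> w" "v \<noteq> w" "\<not> R u v" "\<not> R u w" "\<not> R v w"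
  proof (rule three_independent_elements[of W "3 * k" R])
    show "2 * (3 * k) + 3 \<le> card W" using \<open>\<not> card W < 6 * k + 3\<close> by simp
    show "R y x" if "R x y" for x y using that unfolding R_def by (metis Int_commute)
  qed (use fin deg in auto)
  \<comment> \<open>Without a conflict, a common point is a vertex and so an end of both edges. As
    \<open>x\<close> and \<open>y\<close> differ, that end is one of \<open>a\<close>,
    \<open>b\<close>, \<open>c\<close>.\<close>
  have disj: "path_image (\<gamma> {x, z}) \<inter> path_image (\<gamma> {y, z'}) \<subseteq> {p a, p b, p c}"
    if "x \<in> W" "y \<in> W" "x \<noteq> y" "\<not> R x y" "z \<in> {a, b, c}" "z' \<in> {a, b, c}" for x y z z'
  proof
    fix q assume q: "q \<in> path_image (\<gamma> {x, z}) \<inter> path_image (\<gamma> {y, z'})"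
    have E: "{x, z} \<in> edges G" "{y, z'} \<in> edges G" using ed that by auto
    have "q \<in> p ` verts G" using that q unfolding R_def st_def by blast
    then have "q \<in> p ` {x, z}" "q \<in> p ` {y, z'}"
      using dr E q unfolding drawing_def by blast+
    moreover have "{x, z} \<subseteq> verts G" "{y, z'} \<subseteq> verts G"
      using E sg unfolding simple_graph_def by auto
    ultimately have "q \<in> p ` ({x, z} \<inter> {y, z'})"
      using inj by (auto simp: inj_on_def)
    then show "q \<in> {p a, p b, p c}" using that by auto
  qed
  have star: "\<exists>A B C. star_at (p x) (p a) (p b) (p c) A B C \<and>
      path_image A \<union> path_image B \<union> path_image C =
      path_image (\<gamma> {x, a}) \<union> path_image (\<gamma> {x, b}) \<union> path_image (\<gamma> {x, c})" if "x \<in> W" for x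
    using drawing_star[OF sg dr ne ed[OF that] ed[OF that] ed[OF that]] by (metis insertI1 insertI2)
  have D: "(path_image (\<gamma> {x, a}) \<union> path_image (\<gamma> {x, b}) \<union> path_image (\<gamma> {x, c})) \<inter>
      (path_image (\<gamma> {y, a}) \<union> path_image (\<gamma> {y, b}) \<union> path_image (\<gamma> {y, c})) \<subseteq> {p a, p b, p c}"
    if "x \<in> W" "y \<in> W" "x \<noteq> y" "\<not> R x y" for x y
    unfolding Int_Un_distrib Int_Un_distrib2 by (intro Un_least disj[OF that]) simp_all
  obtain A1 B1 C1 where 1: "star_at (p u) (p a) (p b) (p c) A1 B1 C1"
    "path_image A1 \<union> path_image B1 \<union> path_image C1 =
      path_image (\<gamma> {u, a}) \<union> path_image (\<gamma> {u, b}) \<union> path_image (\<gamma> {u, c})"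
    using star[of u] uvw by auto
  obtain A2 B2 C2 where 2: "star_at (p v) (p a) (p b) (p c) A2 B2 C2"
    "path_image A2 \<union> path_image B2 \<union> path_image C2 =
      path_image (\<gamma> {v, a}) \<union> path_image (\<gamma> {v, b}) \<union> path_image (\<gamma> {v, c})"
    using star[of v] uvw by auto
  obtain A3 B3 C3 where 3: "star_at (p w) (p a) (p b) (p c) A3 B3 C3"
    "path_image A3 \<union> path_image B3 \<union> path_image C3 =
      path_image (\<gamma> {w, a}) \<union> path_image (\<gamma> {w, b}) \<union> path_image (\<gamma> {w, c})"
    using star[of w] uvw by auto
  have mem: "u \<in> W" "v \<in> W" "w \<in> W" using uvw(1) by auto
  show False
    by (rule no_three_disjoint_stars[OF 1(1) 2(1) 3(1)
          D[OF mem(1,2) uvw(2,5), folded 1(2) 2(2)]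
          D[OF mem(1,3) uvw(3,6), folded 1(2) 3(2)]
          D[OF mem(2,3) uvw(4,7), folded 2(2) 3(2)]])
qed

section \<open>Double stars and their placements\<close>

definition double_star :: "'a \<Rightarrow> 'a \<Rightarrow> 'a set \<Rightarrow> 'a set \<Rightarrow> 'a sgraph" where
  "double_star c u L M = \<lparr>verts = insert c (insert u (L \<union> M)),
     edges = insert {c, u} ((\<lambda>x. {c, x}) ` L \<union> (\<lambda>x. {u, x}) ` M)\<rparr>"

lemma doubleton_in_image_iff:
  "{x, y} \<in> (\<lambda>z. {a, z}) ` K \<longleftrightarrow> x = a \<and> y \<in> K \<or> y = a \<and> x \<in> K"
  by (auto simp: image_iff doubleton_eq_iff)

lemma is_cycle_two_neighbours:
  assumes "is_cycle G xs" "x \<in> set xs"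
  obtains y z where "y \<noteq> z" "{x, y} \<in> edges G" "{x, z} \<in> edges G"
proof -
  let ?n = "length xs"
  have n: "?n \<ge> 3" and d: "distinct xs"
    and e: "\<And>i. Suc i < ?n \<Longrightarrow> {xs ! i, xs ! Suc i} \<in> edges G"
    and l: "{last xs, hd xs} \<in> edges G"
    using assms by (auto simp: is_cycle_def)
  have ne: "xs \<noteq> []" using n by auto
  have l: "{xs ! (?n - 1), xs ! 0} \<in> edges G"
    using l ne by (simp add: last_conv_nth hd_conv_nth)
  obtain i where i: "i < ?n" "x = xs ! i" using assms(2) by (auto simp: in_set_conv_nth)
  \<comment> \<open>Cyclic successor and predecessor of position \<open>i\<close>; length at least 3
    keeps them different.\<close>
  define s where "s = (if Suc i = ?n then 0 else Suc i)"
  define r where "r = (if i = 0 then ?n - 1 else i - 1)"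
  have rs: "r < ?n" "s < ?n" "r \<noteq> s" using i n by (auto simp: r_def s_def)
  have "{x, xs ! s} \<in> edges G"
  proof (cases "Suc i = ?n")
    case True
    then have "i = ?n - 1" by simp
    then show ?thesis using l True by (simp add: s_def i)
  next
    case False
    then show ?thesis using e[of i] i by (simp add: s_def)
  qed
  moreover have "{x, xs ! r} \<in> edges G"
  proof (cases i)
    case 0
    then show ?thesis using l by (simp add: r_def i insert_commute)
  next
    case (Suc j)
    then show ?thesis using e[of j] i by (simp add: r_def insert_commute)
  qed
  moreover have "xs ! r \<noteq> xs ! s" using d rs by (simp add: nth_eq_iff_index_eq)
  ultimately show thesis using that by blast
qed

section \<open>Double stars as caterpillars\<close>

locale double_star_graph =
  fixes c u :: 'a and L M :: "'a set"
  assumes fin: "finite L" "finite M"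
    and ne: "c \<noteq> u" "c \<notin> L" "c \<notin> M" "u \<notin> L" "u \<notin> M" "L \<inter> M = {}"
begin

abbreviation "D \<equiv> double_star c u L M"

lemma verts_D: "verts D = insert c (insert u (L \<union> M))"
  and edges_D: "edges D = insert {c, u} ((\<lambda>x. {c, x}) ` L \<union> (\<lambda>x. {u, x}) ` M)"
  by (simp_all add: double_star_def)

lemma simple_graph_D: "simple_graph D"
  using fin ne unfolding simple_graph_def verts_D edges_D by (auto simp: card_insert_if)

lemma edge_iff:
  "{x, y} \<in> edges D \<longleftrightarrow> {x, y} = {c, u} \<or> (x = c \<and> y \<in> L) \<or> (y = c \<and> x \<in> L)
     \<or> (x = u \<and> y \<in> M) \<or> (y = u \<and> x \<in> M)"
  unfolding edges_D insert_iff Un_iff doubleton_in_image_iff by blast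

lemma connected_graph_D: "connected_graph D"
proof -
  have sym: "sym (adj D)"
    by (auto simp: sym_def adj_def insert_commute)
  have cu: "(c, u) \<in> adj D" by (simp add: adj_def edge_iff)
  have toc: "(c, x) \<in> (adj D)\<^sup>*" if x: "x \<in> verts D" for x
  proof -
    consider "x = c" | "x = u" | "x \<in> L" | "x \<in> M" using x by (auto simp: verts_D)
    then show ?thesis
    proof cases
      case 4
      then have "(u, x) \<in> adj D" by (simp add: adj_def edge_iff)
      then show ?thesis using cu by (meson r_into_rtrancl rtrancl_into_rtrancl)
    qed (use cu in \<open>auto simp: adj_def edge_iff\<close>)
  qed
  have "(x, y) \<in> (adj D)\<^sup>*" if "x \<in> verts D" "y \<in> verts D" for x y
    using toc[OF that(1)] toc[OF that(2)] sym_rtrancl[OF sym] by (meson rtrancl_trans symD)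
  then show ?thesis unfolding connected_graph_def by (auto simp: verts_D)
qed

text \<open>Only \<open>c\<close> and \<open>u\<close> can have two different neighbours, which
  leaves too few vertices for a cycle.\<close>

lemma acyclic_D: "\<not> is_cycle D xs"
proof
  assume cyc: "is_cycle D xs"
  have "set xs \<subseteq> {c, u}"
  proof
    fix x assume x: "x \<in> set xs"
    then obtain y z where yz: "y \<noteq> z" "{x, y} \<in> edges D" "{x, z} \<in> edges D"
      using is_cycle_two_neighbours[OF cyc] by blast
    then show "x \<in> {c, u}" using ne unfolding edge_iff by (auto simp: doubleton_eq_iff)
  qed
  then have "card (set xs) \<le> card {c, u}" by (intro card_mono) auto
  moreover have "card (set xs) = length xs" "length xs \<ge> 3"
    using cyc by (auto simp: is_cycle_def distinct_card)
  ultimately show False using ne by simp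
qed

lemma is_tree_D: "is_tree D"
  unfolding is_tree_def using simple_graph_D connected_graph_D acyclic_D by blast

text \<open>With both leaf sets nonempty, \<open>c\<close> and \<open>u\<close> have degree at least
  2, so deleting the leaves leaves exactly the edge between them.\<close>

lemma caterpillar_D:
  assumes "L \<noteq> {}" "M \<noteq> {}"
  shows "caterpillar D"
proof -
  have "degree D x = 1" if "x \<in> L" for x
  proof -
    have "{e \<in> edges D. x \<in> e} = {{c, x}}" using that ne by (auto simp: edges_D)
    then show ?thesis by (simp add: degree_def)
  qed
  moreover have "degree D x = 1" if "x \<in> M" for x
  proof -
    have "{e \<in> edges D. x \<in> e} = {{u, x}}" using that ne by (auto simp: edges_D)
    then show ?thesis by (simp add: degree_def)
  qed
  moreover have finE: "finite (edges D)" using fin by (simp add: edges_D)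
  have "degree D c \<noteq> 1"
  proof -
    obtain l where l: "l \<in> L" using assms by auto
    have "card {{c, u}, {c, l}} \<le> degree D c" unfolding degree_def
      using l finE by (intro card_mono) (auto simp: edges_D)
    moreover have "{c, u} \<noteq> {c, l}" using l ne by (auto simp: doubleton_eq_iff)
    ultimately show ?thesis by simp
  qed
  moreover have "degree D u \<noteq> 1"
  proof -
    obtain m where m: "m \<in> M" using assms by auto
    have "card {{c, u}, {u, m}} \<le> degree D u" unfolding degree_def
      using m finE by (intro card_mono) (auto simp: edges_D)
    moreover have "{c, u} \<noteq> {u, m}" using m ne by (auto simp: doubleton_eq_iff)
    ultimately show ?thesis by simp
  qed
  ultimately have lv: "leaves D = L \<union> M" unfolding leaves_def by (auto simp: verts_D)
  have "is_path_graph (remove_verts D (leaves D))"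
    unfolding is_path_graph_def
  proof (intro exI[of _ "[c, u]"] conjI)
    show "verts (remove_verts D (leaves D)) = set [c, u]"
      using ne by (auto simp: remove_verts_def lv verts_D)
    have "edges (remove_verts D (leaves D)) = {{c, u}}"
      using ne by (auto simp: remove_verts_def lv edges_D)
    also have "\<dots> = {{[c, u] ! i, [c, u] ! Suc i} | i. Suc i < length [c, u]}"
      by (auto intro!: exI[of _ 0])
    finally show "edges (remove_verts D (leaves D)) = \<dots>" .
  qed (use ne in auto)
  then show ?thesis using is_tree_D by (simp add: caterpillar_def)
qed

end

lemma double_star_iso:
  assumes "double_star_graph c u L M" "double_star_graph c' u' L' M'" "card L = card L'" "card M = card M'"
  shows "graph_iso (double_star c u L M) (double_star c' u' L' M')"
proof -
  interpret A: double_star_graph c u L M by fact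
  interpret B: double_star_graph c' u' L' M' by fact
  obtain f g where f: "bij_betw f L L'" and g: "bij_betw g M M'"
    using assms(3,4) A.fin B.fin by (meson finite_same_card_bij)
  define k where "k x = (if x = c then c' else if x = u then u' else if x \<in> L then f x else g x)" for x
  have k: "k c = c'" "k u = u'" "\<And>x. x \<in> L \<Longrightarrow> k x = f x" "\<And>x. x \<in> M \<Longrightarrow> k x = g x"
    using A.ne by (auto simp: k_def)
  have kL: "bij_betw k L L'" using f k(3) by (simp cong: bij_betw_cong)
  have kM: "bij_betw k M M'" using g k(4) by (simp cong: bij_betw_cong)
  have "bij_betw k ({c} \<union> ({u} \<union> (L \<union> M))) ({c'} \<union> ({u'} \<union> (L' \<union> M')))"
    using kL kM B.ne k(1,2) by (intro bij_betw_combine) (auto simp: bij_betw_def)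
  then have "bij_betw k (verts (double_star c u L M)) (verts (double_star c' u' L' M'))"
    unfolding A.verts_D B.verts_D by (simp only: insert_is_Un[of _ "insert _ _"] insert_is_Un[of _ "_ \<union> _"])
  moreover have "L' = k ` L" "M' = k ` M" using kL kM by (auto simp: bij_betw_def)
  then have "edges (double_star c' u' L' M') = (\<lambda>e. k ` e) ` edges (double_star c u L M)"
    unfolding A.edges_D B.edges_D by (simp add: image_Un image_image k(1,2))
  ultimately show ?thesis unfolding graph_iso_def by blast
qed

text \<open>The vertex \<open>j\<close> is the large centre of the \<open>j\<close>-th copy and \<open>h + j\<close> the small one. The copy leaves
  the edges \<open>{j, m}\<close> with \<open>m < j\<close> to copy \<open>m\<close>, and \<open>{j, h + i}\<close> with \<open>i > j\<close> to copy \<open>i\<close>; these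
  vertices \<open>m\<close> and \<open>h + i\<close> are attached to \<open>h + j\<close> instead.\<close>

definition packed_copy :: "nat \<Rightarrow> nat \<Rightarrow> nat \<Rightarrow> nat sgraph" where
  "packed_copy h n j = double_star j (h + j) ({j<..<h} \<union> {h..<h + j} \<union> {2 * h..<n}) ({..<j} \<union> {h + j<..<2 * h})"

lemma double_star_graph_packed_copy:
  fixes j h n :: nat
  shows "j < h \<Longrightarrow> double_star_graph j (h + j) ({j<..<h} \<union> {h..<h + j} \<union> {2 * h..<n}) ({..<j} \<union> {h + j<..<2 * h})"
  by unfold_locales auto

lemma verts_packed_copy: "j < h \<Longrightarrow> 2 * h \<le> n \<Longrightarrow> verts (packed_copy h n j) = {..<n}"
  unfolding packed_copy_def double_star_def by auto

text \<open>The sizes do not depend on \<open>j\<close>, which is what makes all copies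
  isomorphic.\<close>

lemma card_packed_copy:
  fixes j h n :: nat
  assumes "j < h" "2 * h \<le> n"
  shows "card ({j<..<h} \<union> {h..<h + j} \<union> {2 * h..<n}) = n - h - 1"
    "card ({..<j} \<union> {h + j<..<2 * h}) = h - 1"
proof -
  have "card ({j<..<h} \<union> {h..<h + j} \<union> {2 * h..<n}) = (h - Suc j) + j + (n - 2 * h)"
    using assms by (subst card_Un_disjoint, force, force, force, subst card_Un_disjoint) auto
  then show "card ({j<..<h} \<union> {h..<h + j} \<union> {2 * h..<n}) = n - h - 1" using assms by simp
  have "card ({..<j} \<union> {h + j<..<2 * h}) = j + (2 * h - Suc (h + j))"
    by (subst card_Un_disjoint) auto
  then show "card ({..<j} \<union> {h + j<..<2 * h}) = h - 1" using assms by simp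
qed

text \<open>A common edge would join one of \<open>i\<close>, \<open>h + i\<close> to one of
  \<open>j\<close>, \<open>h + j\<close>. For \<open>i < j\<close>, copy \<open>i\<close> owns
  \<open>{i, j}\<close> and \<open>{h + i, h + j}\<close>, while copy \<open>j\<close> owns
  \<open>{i, h + j}\<close> and \<open>{h + i, j}\<close>.\<close>

lemma packed_copies_edge_disjoint:
  assumes "i < h" "j < h" "i \<noteq> j"
  shows "edges (packed_copy h n i) \<inter> edges (packed_copy h n j) = {}"
proof -
  have "edges (packed_copy h n i) \<inter> edges (packed_copy h n j) = {}" if "i < j" "j < h" for i j
    using that unfolding packed_copy_def double_star_def
    by (auto simp: doubleton_eq_iff)
  then show ?thesis using assms by (metis Int_commute nat_neq_iff)
qed

lemma packed_copy_iso:
  "i < h \<Longrightarrow> j < h \<Longrightarrow> 2 * h \<le> n \<Longrightarrow> graph_iso (packed_copy h n i) (packed_copy h n j)"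
  unfolding packed_copy_def by (intro double_star_iso double_star_graph_packed_copy) (simp_all add: card_packed_copy)

lemma placement_packed_copy:
  assumes "0 < h" "2 * h \<le> n"
  shows "\<exists>G :: nat sgraph. is_placement h (packed_copy h n 0) G"
proof
  let ?G = "\<lparr>verts = {..<n}, edges = (\<Union>j<h. edges (packed_copy h n j))\<rparr>"
  have "simple_graph (packed_copy h n j)" if "j < h" for j
    using double_star_graph.simple_graph_D[OF double_star_graph_packed_copy[OF that]] by (simp add: packed_copy_def)
  then have "simple_graph ?G"
    using assms unfolding simple_graph_def by (fastforce simp: verts_packed_copy)
  moreover have "spanning_subgraph (packed_copy h n j) ?G" if "j < h" for j
    using that assms by (auto simp: spanning_subgraph_def verts_packed_copy)
  ultimately show "is_placement h (packed_copy h n 0) ?G"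
    unfolding is_placement_def using assms packed_copy_iso packed_copies_edge_disjoint
    by (intro conjI exI[of _ "packed_copy h n"]) (auto simp: verts_packed_copy)
qed

section \<open>Common neighbours of the star centres in a host graph\<close>

lemma graph_iso_neighbours:
  assumes "graph_iso H F" "N \<subseteq> verts H" "\<And>x. x \<in> N \<Longrightarrow> {c, x} \<in> edges H"
  obtains v N' where "N' \<subseteq> verts F" "card N' = card N" "\<And>x. x \<in> N' \<Longrightarrow> {x, v} \<in> edges F"
proof -
  obtain f where f: "bij_betw f (verts H) (verts F)" "edges F = (\<lambda>e. f ` e) ` edges H"
    using assms(1) by (auto simp: graph_iso_def)
  show thesis
  proof (rule that[of "f ` N" "f c"])
    show "card (f ` N) = card N"
      using f(1) assms(2) by (meson bij_betw_def card_image inj_on_subset)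
    show "{x, f c} \<in> edges F" if x: "x \<in> f ` N" for x
    proof -
      obtain y where y: "y \<in> N" "x = f y" using x by auto
      have "f ` {c, y} \<in> edges F" unfolding f(2) using assms(3)[OF y(1)] by (rule imageI)
      then show ?thesis using y by (simp add: insert_commute)
    qed
    show "f ` N \<subseteq> verts F"
      using image_mono[OF assms(2), of f] unfolding bij_betw_imp_surj_on[OF f(1)] .
  qed
qed

text \<open>Two copies with the same centre would have disjoint neighbourhoods there, of total size
  \<open>2 * card N\<close>, more than the host has vertices. So the centres differ, and each of the
  three neighbourhoods misses only \<open>card (verts C) - card N\<close> vertices.\<close>

lemma placement_common_neighbours:
  assumes pl: "is_placement h C G" and h: "3 \<le> h"
    and C: "finite (verts C)" "N \<subseteq> verts C" "\<And>x. x \<in> N \<Longrightarrow> {c, x} \<in> edges C"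
    and N: "card (verts C) < 2 * card N" "3 * (card (verts C) - card N) + m \<le> card (verts C)"
  obtains v0 v1 v2 W where "v0 \<noteq> v1" "v0 \<noteq> v2" "v1 \<noteq> v2" "finite W" "m \<le> card W"
    "\<And>w v. w \<in> W \<Longrightarrow> v \<in> {v0, v1, v2} \<Longrightarrow> {w, v} \<in> edges G"
proof -
  obtain F where F: "\<And>i. i < h \<Longrightarrow> spanning_subgraph (F i) G" "\<And>i. i < h \<Longrightarrow> graph_iso C (F i)"
    "\<And>i j. i < h \<Longrightarrow> j < h \<Longrightarrow> i \<noteq> j \<Longrightarrow> edges (F i) \<inter> edges (F j) = {}"
    using pl unfolding is_placement_def by metis
  have G: "finite (verts G)" "card (verts G) = card (verts C)"
    using pl by (simp_all add: is_placement_def simple_graph_def)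
  have "\<exists>v N'. N' \<subseteq> verts G \<and> card N' = card N \<and> (\<forall>x\<in>N'. {x, v} \<in> edges (F i))" if i: "i < h" for i
  proof -
    obtain v N' where N': "N' \<subseteq> verts (F i)" "card N' = card N"
      "\<And>x. x \<in> N' \<Longrightarrow> {x, v} \<in> edges (F i)"
      using graph_iso_neighbours[OF F(2)[OF i], of N c] C(2,3) by metis
    moreover have "verts (F i) = verts G" using F(1)[OF i] by (simp add: spanning_subgraph_def)
    ultimately show ?thesis by (intro exI[of _ v] exI[of _ N'] conjI ballI) simp_all
  qed
  then obtain v X where vX: "\<And>i. i < h \<Longrightarrow> X i \<subseteq> verts G" "\<And>i. i < h \<Longrightarrow> card (X i) = card N"
    "\<And>i x. i < h \<Longrightarrow> x \<in> X i \<Longrightarrow> {x, v i} \<in> edges (F i)"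
    by metis
  have inj: "v i \<noteq> v j" if "i < h" "j < h" "i \<noteq> j" for i j
  proof
    assume eq: "v i = v j"
    have "X i \<inter> X j = {}"
      using vX(3)[OF that(1)] vX(3)[OF that(2)] F(3)[OF that] eq by auto
    then have "card (X i \<union> X j) = 2 * card N"
      using vX that G by (subst card_Un_disjoint) (auto intro: finite_subset)
    moreover have "card (X i \<union> X j) \<le> card (verts G)"
      using vX(1) that G by (intro card_mono) auto
    ultimately show False using N G by simp
  qed
  define W where "W = X 0 \<inter> X 1 \<inter> X 2"
  have co: "card (verts G - X i) = card (verts C) - card N" if "i < h" for i
    using vX[OF that] G by (simp add: card_Diff_subset finite_subset)
  have "verts G \<subseteq> W \<union> ((verts G - X 0) \<union> ((verts G - X 1) \<union> (verts G - X 2)))"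
    unfolding W_def by auto
  then have "card (verts G) \<le> card (W \<union> ((verts G - X 0) \<union> ((verts G - X 1) \<union> (verts G - X 2))))"
    using G h vX(1)[of 0] by (intro card_mono) (auto simp: W_def intro: finite_subset)
  also have "\<dots> \<le> card W + (card (verts G - X 0) + (card (verts G - X 1) + card (verts G - X 2)))"
    by (intro order_trans[OF card_Un_le] add_left_mono) (rule order_refl)
  also have "\<dots> = card W + 3 * (card (verts C) - card N)" using h by (simp add: co)
  finally have "m \<le> card W" using N G by simp
  moreover have "finite W" unfolding W_def using vX(1)[of 0] h G by (auto intro: finite_subset)
  moreover have "{w, z} \<in> edges G" if "w \<in> W" "z \<in> {v 0, v 1, v 2}" for w z
  proof -
    have "{x, v i} \<in> edges G" if "i < h" "x \<in> X i" for i x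
      using vX(3)[OF that] F(1)[OF that(1)] by (auto simp: spanning_subgraph_def)
    then show ?thesis using that h unfolding W_def by auto
  qed
  ultimately show thesis
    using that[of "v 0" "v 1" "v 2" W] inj[of 0 1] inj[of 0 2] inj[of 1 2] h by auto
qed

lemma caterpillar_placements_not_k_planar:
  fixes h N :: nat
  assumes h: "3 \<le> h"
  obtains C :: "nat sgraph" where "caterpillar C" "N \<le> card (verts C)"
    "\<exists>G :: nat sgraph. is_placement h C G"
    "\<And>k (G :: 'b sgraph). is_placement h C G \<Longrightarrow> k_planar k G \<Longrightarrow> N \<le> k"
proof
  \<comment> \<open>The large centre has degree \<open>n - h\<close>, so three neighbourhoods miss
    at most \<open>3 * h\<close> vertices in all; the remaining \<open>6 * N + 3\<close> common
    neighbours rule out every \<open>k < N\<close>, and also every \<open>k\<close> with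
    \<open>6 * k < 6 * N\<close>.\<close>
  define n where "n = 3 * h + 6 * N + 3"
  let ?L = "{0<..<h} \<union> {2 * h..<n}"
  have C0: "packed_copy h n 0 = double_star 0 h ?L {h<..<2 * h}"
    by (simp add: packed_copy_def)
  interpret double_star_graph 0 h ?L "{h<..<2 * h}"
    using double_star_graph_packed_copy[of 0 h n] h by simp
  have verts: "verts (packed_copy h n 0) = {..<n}"
    using h by (simp add: verts_packed_copy n_def)
  show "caterpillar (packed_copy h n 0)"
  proof -
    have "1 \<in> {0<..<h}" "Suc h \<in> {h<..<2 * h}" using h by auto
    then show ?thesis unfolding C0 by (intro caterpillar_D) blast+
  qed
  show "N \<le> card (verts (packed_copy h n 0))" unfolding verts by (simp add: n_def)
  show "\<exists>G :: nat sgraph. is_placement h (packed_copy h n 0) G"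
    using h by (intro placement_packed_copy) (auto simp: n_def)
  fix k and G :: "'b sgraph"
  assume pl: "is_placement h (packed_copy h n 0) G" and kp: "k_planar k G"
  have "card ?L = n - h - 1"
    using card_packed_copy(1)[of 0 h n] h by (simp add: n_def)
  \<comment> \<open>The small centre \<open>h\<close> is itself a neighbour of the large centre
    0.\<close>
  then have cN: "card (insert h ?L) = n - h"
    using h by (subst card_insert_disjoint) (auto simp: n_def)
  show "N \<le> k"
  proof (rule placement_common_neighbours[OF pl h, where c = 0 and N = "insert h ?L" and m = "6 * N + 3"])
    fix v0 v1 v2 W
    assume v: "v0 \<noteq> v1" "v0 \<noteq> v2" "v1 \<noteq> v2" "finite W" "6 * N + 3 \<le> card W"
      "\<And>w v. w \<in> W \<Longrightarrow> v \<in> {v0, v1, v2} \<Longrightarrow> {w, v} \<in> edges G"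
    have "simple_graph G" using pl by (simp add: is_placement_def)
    from k_planar_common_neighbours[OF this kp v(1-4,6)] v(5) show "N \<le> k" by simp
  next
    show "{0, x} \<in> edges (packed_copy h n 0)" if "x \<in> insert h ?L" for x
      using that unfolding C0 edge_iff by blast
    show "finite (verts (packed_copy h n 0))" by (simp add: verts)
    show "insert h ?L \<subseteq> verts (packed_copy h n 0)" unfolding verts by (auto simp: n_def)
    show "card (verts (packed_copy h n 0)) < 2 * card (insert h ?L)"
      "3 * (card (verts (packed_copy h n 0)) - card (insert h ?L)) + (6 * N + 3) \<le> card (verts (packed_copy h n 0))"
      unfolding verts cN using h by (simp_all add: n_def)
  qed
qed

theorem theorem6:
  shows "(\<forall>h \<in> {3, 4 :: nat}. \<exists>C :: nat sgraph.
            caterpillar C \<and> card (verts C) \<ge> h + 7 \<and>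
            (\<exists>G :: nat sgraph. is_placement h C G) \<and>
            (\<forall>(k :: nat) (G :: nat sgraph). is_placement h C G \<and> k_planar k G \<longrightarrow> k \<ge> h - 1)) \<and>
         (\<exists>C :: nat sgraph.
            caterpillar C \<and> card (verts C) \<ge> 24 \<and>
            (\<exists>G :: nat sgraph. is_placement 5 C G) \<and>
            (\<forall>(k :: nat) (G :: nat sgraph). is_placement 5 C G \<and> k_planar k G \<longrightarrow> k \<ge> 5))"
proof (intro conjI ballI)
  fix h :: nat assume "h \<in> {3, 4}"
  then have "3 \<le> h" by auto
  \<comment> \<open>The value \<open>h + 7\<close> serves both as the required number of vertices
    and as a bound on \<open>k\<close> exceeding \<open>h - 1\<close>.\<close>
  then obtain C :: "nat sgraph" where "caterpillar C" "h + 7 \<le> card (verts C)"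
    "\<exists>G :: nat sgraph. is_placement h C G"
    and k: "\<And>k (G :: nat sgraph). is_placement h C G \<Longrightarrow> k_planar k G \<Longrightarrow> h + 7 \<le> k"
    using caterpillar_placements_not_k_planar[of h "h + 7", where 'b = nat] by metis
  moreover have "h - 1 \<le> k" if "is_placement h C G" "k_planar k G" for k and G :: "nat sgraph"
    using k[OF that] by simp
  ultimately show "\<exists>C :: nat sgraph. caterpillar C \<and> card (verts C) \<ge> h + 7 \<and>
      (\<exists>G :: nat sgraph. is_placement h C G) \<and>
      (\<forall>(k :: nat) (G :: nat sgraph). is_placement h C G \<and> k_planar k G \<longrightarrow> k \<ge> h - 1)"
    by blast
next
  obtain C :: "nat sgraph" where "caterpillar C" "24 \<le> card (verts C)"
    "\<exists>G :: nat sgraph. is_placement 5 C G"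
    and k: "\<And>k (G :: nat sgraph). is_placement 5 C G \<Longrightarrow> k_planar k G \<Longrightarrow> 24 \<le> k"
    using caterpillar_placements_not_k_planar[of 5 24, where 'b = nat] by auto
  moreover have "5 \<le> k" if "is_placement 5 C G" "k_planar k G" for k and G :: "nat sgraph"
    using k[OF that] by simp
  ultimately show "\<exists>C :: nat sgraph. caterpillar C \<and> card (verts C) \<ge> 24 \<and>
      (\<exists>G :: nat sgraph. is_placement 5 C G) \<and>
      (\<forall>(k :: nat) (G :: nat sgraph). is_placement 5 C G \<and> k_planar k G \<longrightarrow> k \<ge> 5)"
    by blast
qed

end
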